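(* As $n\to\infty$, $$E_{\pi\in S_n}[d_{-}(\pi)]=n\ln n+O(n)\qquad\text{and}\qquad E_{\pi\in S_n}[d(\pi)]=2n\ln n+O(n).$$
   Context: $S_n$ is the symmetric group on $\{1,\dots,n\}$, and $E_{\pi\in S_n}$ denotes the expectation over $\pi$ uniformly distributed in $S_n$. For $1\le a<b\le n$, $t_{a,b}\in S_n$ is the transposition interchanging $a$ and $b$; $t_{a,b}\pi$ is obtained from $\pi=[\pi(1),\dots,\pi(n)]$ by interchanging the values $a$ and $b$. The length $\ell(\pi)$ is the minimal $k$ such that $\pi$ is a product of $k$ adjacent transpositions $s_i=t_{i,i+1}$ ($1\le i<n$). The down degree $d_{-}(\pi)$ is the number of permutations covered by $\pi$ in the strong Bruhat order on $S_n$, and the total degree $d(\pi)$ is the number of permutations covered by $\pi$ plus the number of permutations covering $\pi$; equivalently $d_{-}(\pi)=\#\{t_{a,b} \mid a<b,\ \ell(t_{a,b}\pi)=\ell(\pi)-1\}$ and $d(\pi)=\#\{t_{a,b}\mid a<b,\ \ell(t_{a,b}\pi)=\ell(\pi)\pm1\}$. *)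

theory Defs
  imports
    "HOL-Probability.Probability"
    "HOL-Combinatorics.Permutations"
    "HOL-Library.Landau_Symbols"
begin

text \<open>
  \<open>S\<^sub>n\<close> is the set of functions permuting \<open>{1..n}\<close> and fixing all other natural numbers.
\<close>

definition Sym :: "nat \<Rightarrow> (nat \<Rightarrow> nat) set" where
  "Sym n = {\<pi>. \<pi> permutes {1..n}}"

abbreviation transp :: "nat \<Rightarrow> nat \<Rightarrow> nat \<Rightarrow> nat" where
  "transp a b \<equiv> Transposition.transpose a b"

definition adj_product :: "nat list \<Rightarrow> nat \<Rightarrow> nat" where
  "adj_product is = foldr (\<lambda>i \<pi>. transp i (i + 1) \<circ> \<pi>) is id"

definition perm_length :: "nat \<Rightarrow> (nat \<Rightarrow> nat) \<Rightarrow> nat" where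
  "perm_length n \<pi> = (LEAST k. \<exists>is. length is = k \<and> set is \<subseteq> {1..<n} \<and> \<pi> = adj_product is)"

text \<open>
  The strong Bruhat order is the reflexive and transitive closure of the relation
  \<open>\<sigma> \<rightarrow> t\<^sub>a\<^sub>,\<^sub>b \<sigma>\<close> whenever the length increases, by any amount. Multiplying by
  transpositions on the right instead gives the same relation, since transpositions are
  closed under conjugation.
\<close>

definition bruhat_step :: "nat \<Rightarrow> (nat \<Rightarrow> nat) rel" where
  "bruhat_step n = {(\<sigma>, \<tau>). \<sigma> \<in> Sym n \<and>
     (\<exists>a b. 1 \<le> a \<and> a < b \<and> b \<le> n \<and> \<tau> = transp a b \<circ> \<sigma>) \<and>
     perm_length n \<sigma> < perm_length n \<tau>}"

definition bruhat_le :: "nat \<Rightarrow> (nat \<Rightarrow> nat) \<Rightarrow> (nat \<Rightarrow> nat) \<Rightarrow> bool" where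
  "bruhat_le n \<sigma> \<tau> \<longleftrightarrow> \<sigma> \<in> Sym n \<and> \<tau> \<in> Sym n \<and> (\<sigma>, \<tau>) \<in> (bruhat_step n)\<^sup>*"

definition bruhat_less :: "nat \<Rightarrow> (nat \<Rightarrow> nat) \<Rightarrow> (nat \<Rightarrow> nat) \<Rightarrow> bool" where
  "bruhat_less n \<sigma> \<tau> \<longleftrightarrow> bruhat_le n \<sigma> \<tau> \<and> \<sigma> \<noteq> \<tau>"

definition bruhat_covers :: "nat \<Rightarrow> (nat \<Rightarrow> nat) \<Rightarrow> (nat \<Rightarrow> nat) \<Rightarrow> bool" where
  "bruhat_covers n \<tau> \<sigma> \<longleftrightarrow> bruhat_less n \<sigma> \<tau> \<and>
     \<not> (\<exists>\<rho>. bruhat_less n \<sigma> \<rho> \<and> bruhat_less n \<rho> \<tau>)"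

definition down_degree :: "nat \<Rightarrow> (nat \<Rightarrow> nat) \<Rightarrow> nat" where
  "down_degree n \<pi> = card {\<sigma>. bruhat_covers n \<pi> \<sigma>}"

definition total_degree :: "nat \<Rightarrow> (nat \<Rightarrow> nat) \<Rightarrow> nat" where
  "total_degree n \<pi> = card {\<sigma>. bruhat_covers n \<pi> \<sigma>} + card {\<sigma>. bruhat_covers n \<sigma> \<pi>}"

definition expect_Sym :: "nat \<Rightarrow> ((nat \<Rightarrow> nat) \<Rightarrow> real) \<Rightarrow> real" where
  "expect_Sym n f = measure_pmf.expectation (pmf_of_set (Sym n)) f"

end

theory Submission
  imports Defs
begin

text \<open>
  A cover in the Bruhat order exchanges the entries of a permutation at two positions
  \<open>i < j\<close> such that no entry strictly between these positions has a value strictly between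
  the two exchanged values. The source of this description is the effect of such an exchange on
  the number of inversions: if the two entries are in increasing order, the number grows by one
  plus twice the number of entries that lie between them both in position and in value
  (\<open>inversions_swap\<close>). In particular the length equals the number of inversions
  (\<open>perm_length_eq_inversions\<close>), an exchange with nothing in between raises the length by
  exactly one and hence is a cover, and any other exchange factors through smaller ones
  (\<open>bruhat_covers_iff\<close>).

  Both degrees therefore count pairs of positions \<open>i < j\<close> for which the values at \<open>i\<close> and
  \<open>j\<close> are neighbours in the ordered list of all values on the window \<open>{i..j}\<close>; the down degree
  takes the pairs with the larger value first, the up degree those with the larger value last.
  For a window of \<open>m\<close> positions, every permutation has \<open>m - 1\<close> neighbouring pairs of values,
  and these are equally likely to sit at any of the \<open>m (m - 1)\<close> ordered pairs of positions,
  since a uniform permutation stays uniform when the positions in the window are rearranged. So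
  each of the two events has probability \<open>1 / m\<close> (\<open>card_permutations_adjacent\<close>).

  There are \<open>n + 1 - m\<close> windows of size \<open>m\<close>, so the expected down degree and the expected up
  degree are both \<open>(\<Sum>m = 2..n. (n + 1 - m) / m) = (n + 1) H\<^sub>n - 2 n\<close> with the harmonic
  number \<open>H\<^sub>n\<close> (\<open>expected_degrees\<close>), and \<open>ln n \<le> H\<^sub>n \<le> ln n + 1\<close> finishes the proof.
\<close>

section \<open>Inversions and length\<close>

definition inversions :: "nat \<Rightarrow> (nat \<Rightarrow> nat) \<Rightarrow> nat" where
  "inversions n \<pi> = card {(i, j). 1 \<le> i \<and> i < j \<and> j \<le> n \<and> \<pi> j < \<pi> i}"

lemma of_nat_card_filter:
  "finite A \<Longrightarrow> (of_nat (card {x \<in> A. P x}) :: 'a::semiring_1) = (\<Sum>x\<in>A. of_bool (P x))"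
  by (simp add: Int_def)

lemma inversions_as_sum:
  "int (inversions n \<pi>) = (\<Sum>p\<in>{1..n}. \<Sum>q\<in>{1..n}. of_bool (p < q \<and> \<pi> q < \<pi> p))"
proof -
  have "(\<Sum>p\<in>{1..n}. \<Sum>q\<in>{1..n}. of_bool (p < q \<and> \<pi> q < \<pi> p) :: int)
      = (\<Sum>z\<in>{1..n} \<times> {1..n}. of_bool (fst z < snd z \<and> \<pi> (snd z) < \<pi> (fst z)))"
    by (subst sum.cartesian_product) (simp only: case_prod_unfold)
  also have "\<dots> = int (card {z \<in> {1..n} \<times> {1..n}. fst z < snd z \<and> \<pi> (snd z) < \<pi> (fst z)})"
    by (simp add: of_bool_def sum.If_cases Int_def)
  also have "{z \<in> {1..n} \<times> {1..n}. fst z < snd z \<and> \<pi> (snd z) < \<pi> (fst z)}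
      = {(i, j). 1 \<le> i \<and> i < j \<and> j \<le> n \<and> \<pi> j < \<pi> i}"
    by auto
  finally show ?thesis by (simp add: inversions_def)
qed

lemma inversions_id: "inversions n id = 0"
proof -
  have "{(i, j). 1 \<le> i \<and> i < j \<and> j \<le> n \<and> id j < id i} = {}" by auto
  thus ?thesis by (simp only: inversions_def card.empty)
qed

text \<open>
  Isolates the terms of a double sum in which the two special indices \<open>i\<close> and \<open>j\<close> occur; an
  exchange of the entries at \<open>i\<close> and \<open>j\<close> leaves the remaining double sum unchanged.
\<close>

lemma sum_square_insert2:
  fixes g :: "'a \<Rightarrow> 'a \<Rightarrow> 'b::comm_monoid_add"
  assumes "finite R" "i \<notin> R" "j \<notin> R" "i \<noteq> j"
  shows "(\<Sum>p\<in>insert i (insert j R). \<Sum>q\<in>insert i (insert j R). g p q) =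
    (g i i + g i j + g j i + g j j) + (\<Sum>k\<in>R. g i k + g k i + g j k + g k j)
    + (\<Sum>p\<in>R. \<Sum>q\<in>R. g p q)"
  using assms by (simp add: sum.distrib ac_simps)

definition between_positions :: "(nat \<Rightarrow> nat) \<Rightarrow> nat \<Rightarrow> nat \<Rightarrow> nat set" where
  "between_positions \<pi> i j = {k. i < k \<and> k < j \<and> \<pi> i < \<pi> k \<and> \<pi> k < \<pi> j}"

text \<open>
  Pairs of positions avoiding both \<open>i\<close> and \<open>j\<close> are unaffected, and the pair \<open>{i, j}\<close> itself
  becomes an inversion. For a third position \<open>k\<close>, the pairs \<open>{i, k}\<close> and \<open>{j, k}\<close> contain
  equally many inversions before and after, except when \<open>k\<close> lies between in position and in
  value: then both pairs turn into inversions.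
\<close>

lemma inversions_swap:
  assumes inj: "inj_on \<pi> {1..n}" and ij: "1 \<le> i" "i < j" "j \<le> n" and less: "\<pi> i < \<pi> j"
  shows "inversions n (\<pi> \<circ> transp i j) = inversions n \<pi> + 1 + 2 * card (between_positions \<pi> i j)"
proof -
  define R where "R = {1..n} - {i, j}"
  have dom: "{1..n} = insert i (insert j R)" and R: "finite R" "i \<notin> R" "j \<notin> R" "i \<noteq> j"
    using ij by (auto simp: R_def)
  let ?\<tau> = "\<pi> \<circ> transp i j"
  define g where "g \<rho> p q = (of_bool (p < q \<and> \<rho> q < \<rho> p) :: int)" for \<rho> :: "nat \<Rightarrow> nat" and p q
  have decomp: "int (inversions n \<rho>) = (g \<rho> i i + g \<rho> i j + g \<rho> j i + g \<rho> j j)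
      + (\<Sum>k\<in>R. g \<rho> i k + g \<rho> k i + g \<rho> j k + g \<rho> k j) + (\<Sum>p\<in>R. \<Sum>q\<in>R. g \<rho> p q)" for \<rho>
    unfolding inversions_as_sum dom g_def by (rule sum_square_insert2[OF R])
  have rest: "(\<Sum>p\<in>R. \<Sum>q\<in>R. g ?\<tau> p q) = (\<Sum>p\<in>R. \<Sum>q\<in>R. g \<pi> p q)"
    by (intro sum.cong refl) (auto simp: g_def R_def Transposition.transpose_def)
  have mixed: "g ?\<tau> i k + g ?\<tau> k i + g ?\<tau> j k + g ?\<tau> k j =
      (g \<pi> i k + g \<pi> k i + g \<pi> j k + g \<pi> k j) + 2 * of_bool (k \<in> between_positions \<pi> i j)"
    if k: "k \<in> R" for k
  proof -
    have ne: "k \<noteq> i" "k \<noteq> j" and mem: "k \<in> {1..n}" "i \<in> {1..n}" "j \<in> {1..n}"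
      using k ij by (auto simp: R_def)
    have "\<pi> k \<noteq> \<pi> i" "\<pi> k \<noteq> \<pi> j"
      using ne mem by (simp_all add: inj_on_eq_iff[OF inj])
    then consider "\<pi> k < \<pi> i" | "\<pi> i < \<pi> k" "\<pi> k < \<pi> j" | "\<pi> j < \<pi> k" by linarith
    note value_cases = this
    have \<tau>: "?\<tau> i = \<pi> j" "?\<tau> j = \<pi> i" "?\<tau> k = \<pi> k"
      using ne by (simp_all add: Transposition.transpose_def)
    consider "k < i" | "i < k" "k < j" | "j < k" using ne by linarith
    thus ?thesis
      unfolding g_def \<tau> using ij(2) less
      by cases (cases rule: value_cases; simp add: between_positions_def)+
  qed
  have "between_positions \<pi> i j \<subseteq> R" using ij by (auto simp: between_positions_def R_def)
  hence "(\<Sum>k\<in>R. 2 * of_bool (k \<in> between_positions \<pi> i j) :: int) = 2 * int (card (between_positions \<pi> i j))"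
    using R by (simp add: sum_distrib_left[symmetric] of_bool_def sum.If_cases Int_absorb1)
  hence "(\<Sum>k\<in>R. g ?\<tau> i k + g ?\<tau> k i + g ?\<tau> j k + g ?\<tau> k j)
      = (\<Sum>k\<in>R. g \<pi> i k + g \<pi> k i + g \<pi> j k + g \<pi> k j) + 2 * int (card (between_positions \<pi> i j))"
    using mixed by (simp add: sum.distrib)
  moreover have "g ?\<tau> i i + g ?\<tau> i j + g ?\<tau> j i + g ?\<tau> j j
      = (g \<pi> i i + g \<pi> i j + g \<pi> j i + g \<pi> j j) + 1"
    using ij less by (auto simp: g_def)
  ultimately have "int (inversions n ?\<tau>) = int (inversions n \<pi>) + 1 + 2 * int (card (between_positions \<pi> i j))"
    using decomp[of ?\<tau>] decomp[of \<pi>] rest by linarith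
  thus ?thesis by linarith
qed

lemma finite_Sym: "finite (Sym n)"
  unfolding Sym_def by (rule finite_permutations) (rule finite_atLeastAtMost)

lemma card_Sym: "card (Sym n) = fact n"
  unfolding Sym_def by (rule card_permutations) simp_all

lemma Sym_inj: "\<pi> \<in> Sym n \<Longrightarrow> inj \<pi>"
  by (auto simp: Sym_def permutes_inj)

lemma Sym_inj_on: "\<pi> \<in> Sym n \<Longrightarrow> inj_on \<pi> S"
  using Sym_inj inj_on_subset by blast

lemma Sym_compose_transp:
  assumes "\<pi> \<in> Sym n" "a \<in> {1..n}" "b \<in> {1..n}"
  shows "transp a b \<circ> \<pi> \<in> Sym n" "\<pi> \<circ> transp a b \<in> Sym n"
  using assms by (auto simp: Sym_def intro!: permutes_compose permutes_swap_id)

lemma transp_compose_inj: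
  assumes "inj \<pi>"
  shows "transp (\<pi> i) (\<pi> j) \<circ> \<pi> = \<pi> \<circ> transp i j"
proof
  fix x
  consider "x = i" | "x = j" | "x \<noteq> i" "x \<noteq> j" by blast
  thus "(transp (\<pi> i) (\<pi> j) \<circ> \<pi>) x = (\<pi> \<circ> transp i j) x"
  proof cases
    case 3
    hence "\<pi> x \<noteq> \<pi> i" "\<pi> x \<noteq> \<pi> j" by (simp_all only: inj_eq[OF assms] not_False_eq_True)
    thus ?thesis using 3 by simp
  qed simp_all
qed

text \<open>
  Length and Bruhat order are defined through exchanges of values, that is, multiplication on
  the left, whereas inversions are easier to follow through exchanges of positions.
\<close>

lemma value_swap_as_position_swap:
  assumes \<pi>: "\<pi> \<in> Sym n" and a: "a \<in> {1..n}" and b: "b \<in> {1..n}" and ab: "a \<noteq> b"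
  obtains i j where "1 \<le> i" "i < j" "j \<le> n" "transp a b \<circ> \<pi> = \<pi> \<circ> transp i j"
    "{\<pi> i, \<pi> j} = {a, b}"
proof -
  have perm: "\<pi> permutes {1..n}" using \<pi> by (simp add: Sym_def)
  obtain p q where pq: "p \<in> {1..n}" "q \<in> {1..n}" "\<pi> p = a" "\<pi> q = b"
    using permutes_image[OF perm] a b by (metis imageE)
  have eq: "transp a b \<circ> \<pi> = \<pi> \<circ> transp p q"
    using transp_compose_inj[OF Sym_inj[OF \<pi>], of p q] pq by simp
  have "p \<noteq> q" using pq ab by auto
  thus thesis
    using that[of p q] that[of q p] pq eq
    by (cases "p < q") (auto simp: transpose_commute insert_commute)
qed

text \<open>
  No value lies strictly between \<open>a\<close> and \<open>a + 1\<close>, so an adjacent transposition changes the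
  number of inversions by exactly one, and a word of \<open>k\<close> letters creates at most \<open>k\<close> inversions.
\<close>

lemma adj_product_Sym_inversions:
  assumes "set is \<subseteq> {1..<n}"
  shows "adj_product is \<in> Sym n \<and> inversions n (adj_product is) \<le> length is"
  using assms
proof (induction "is")
  case Nil
  have "adj_product [] = id" by (simp add: adj_product_def)
  moreover have "(id :: nat \<Rightarrow> nat) \<in> Sym n" unfolding Sym_def using permutes_id by blast
  ultimately show ?case by (simp only: inversions_id) simp
next
  case (Cons a xs)
  let ?\<pi> = "adj_product xs"
  have \<pi>: "?\<pi> \<in> Sym n" and le: "inversions n ?\<pi> \<le> length xs" using Cons by auto
  have a: "a \<in> {1..n}" "a + 1 \<in> {1..n}" using Cons.prems by auto
  have step: "adj_product (a # xs) = transp a (a + 1) \<circ> ?\<pi>" by (simp add: adj_product_def)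
  have in_Sym: "adj_product (a # xs) \<in> Sym n"
    unfolding step using Sym_compose_transp \<pi> a by blast
  obtain i j where ij: "1 \<le> i" "i < j" "j \<le> n" "transp a (a + 1) \<circ> ?\<pi> = ?\<pi> \<circ> transp i j"
    "{?\<pi> i, ?\<pi> j} = {a, a + 1}"
    using value_swap_as_position_swap[OF \<pi> a] by auto
  have "inversions n (?\<pi> \<circ> transp i j) \<le> inversions n ?\<pi> + 1"
  proof (cases "?\<pi> i < ?\<pi> j")
    case True
    have "between_positions ?\<pi> i j = {}" using True ij(5) by (auto simp: between_positions_def doubleton_eq_iff)
    thus ?thesis
      using inversions_swap[OF Sym_inj_on[OF \<pi>] ij(1-3) True] by simp
  next
    case False
    hence gt: "?\<pi> j < ?\<pi> i" using ij(5) by (auto simp: doubleton_eq_iff)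
    \<comment> \<open>Here the exchange removes an inversion; this follows by exchanging back.\<close>
    have "inversions n ((?\<pi> \<circ> transp i j) \<circ> transp i j)
        = inversions n (?\<pi> \<circ> transp i j) + 1 + 2 * card (between_positions (?\<pi> \<circ> transp i j) i j)"
      using gt ij(1-3) by (intro inversions_swap Sym_inj_on[of _ n]) (simp_all add: in_Sym[unfolded step ij(4)])
    thus ?thesis by (simp add: comp_assoc)
  qed
  hence "inversions n (adj_product (a # xs)) \<le> inversions n ?\<pi> + 1"
    unfolding step ij(4) .
  with in_Sym le show ?case by simp
qed

text \<open>
  If every value \<open>a\<close> stood to the left of \<open>a + 1\<close>, then the inverse of \<open>\<pi>\<close> would be increasing
  on \<open>{1..n}\<close> and \<open>\<pi>\<close> would be the identity.
\<close>

lemma descent_exists: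
  assumes \<pi>: "\<pi> \<in> Sym n" and "\<pi> \<noteq> id"
  obtains a where "a \<in> {1..<n}" "transp a (a + 1) \<circ> \<pi> \<in> Sym n"
    "inversions n \<pi> = inversions n (transp a (a + 1) \<circ> \<pi>) + 1"
proof -
  have perm: "\<pi> permutes {1..n}" using \<pi> by (simp add: Sym_def)
  define q where "q = inv \<pi>"
  have q: "q permutes {1..n}" using perm by (simp add: q_def permutes_inv)
  have \<pi>q: "\<pi> (q x) = x" for x using perm by (simp add: q_def permutes_inverses)
  have "\<exists>a\<in>{1..<n}. q (a + 1) < q a"
  proof (rule ccontr)
    assume "\<not> ?thesis"
    hence mono: "q a \<le> q (a + 1)" if "a \<in> {1..<n}" for a using that by force
    have "1 \<le> i \<Longrightarrow> i \<le> n \<Longrightarrow> i \<le> q i" for i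
    proof (induction i)
      case (Suc i)
      show ?case
      proof (cases "i = 0")
        case True
        thus ?thesis using permutes_in_image[OF q, of 1] Suc.prems by auto
      next
        case False
        hence "i \<le> q i" "q i \<le> q (i + 1)" using Suc mono[of i] by auto
        moreover have "q i \<noteq> q (i + 1)" using \<pi>q by (metis n_not_Suc_n Suc_eq_plus1)
        ultimately show ?thesis by simp
      qed
    qed simp
    hence "q = id" using permutes_natset_ge[OF q] by auto
    hence "\<pi> = id" using \<pi>q by (auto simp: fun_eq_iff)
    thus False using assms by simp
  qed
  then obtain a where a: "a \<in> {1..<n}" "q (a + 1) < q a" by blast
  have rng: "q (a + 1) \<in> {1..n}" "q a \<in> {1..n}"
    unfolding permutes_in_image[OF q] using a by auto
  let ?\<rho> = "transp a (a + 1) \<circ> \<pi>"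
  have \<rho>: "?\<rho> \<in> Sym n" using Sym_compose_transp(1)[OF \<pi>] a by auto
  have swap_back: "?\<rho> \<circ> transp (q (a + 1)) (q a) = \<pi>"
  proof -
    have "\<pi> x = y \<longleftrightarrow> x = q y" for x y using \<pi>q Sym_inj[OF \<pi>] by (metis injD)
    hence "?\<rho> = \<pi> \<circ> transp (q (a + 1)) (q a)"
      using a(2) by (auto simp: fun_eq_iff Transposition.transpose_def \<pi>q)
    thus ?thesis by (simp add: comp_assoc)
  qed
  have "between_positions ?\<rho> (q (a + 1)) (q a) = {}"
    using \<pi>q by (auto simp: between_positions_def Transposition.transpose_def)
  hence "inversions n \<pi> = inversions n ?\<rho> + 1"
    using inversions_swap[OF Sym_inj_on[OF \<rho>], of "q (a + 1)" "q a"] swap_back rng a \<pi>q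
    by simp
  thus thesis using that a \<rho> by blast
qed

lemma reduced_word_exists:
  "\<pi> \<in> Sym n \<Longrightarrow> \<exists>is. length is = inversions n \<pi> \<and> set is \<subseteq> {1..<n} \<and> \<pi> = adj_product is"
proof (induction "inversions n \<pi>" arbitrary: \<pi> rule: less_induct)
  case less
  show ?case
  proof (cases "\<pi> = id")
    case True
    thus ?thesis by (intro exI[of _ "[]"]) (auto simp: adj_product_def inversions_id)
  next
    case False
    then obtain a where a: "a \<in> {1..<n}" "transp a (a + 1) \<circ> \<pi> \<in> Sym n"
      "inversions n \<pi> = inversions n (transp a (a + 1) \<circ> \<pi>) + 1"
      using descent_exists[OF less.prems] by blast
    then obtain xs where xs: "length xs = inversions n (transp a (a + 1) \<circ> \<pi>)"
      "set xs \<subseteq> {1..<n}" "transp a (a + 1) \<circ> \<pi> = adj_product xs"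
      using less.hyps[OF _ a(2)] by auto
    have "adj_product (a # xs) = transp a (a + 1) \<circ> (transp a (a + 1) \<circ> \<pi>)"
      using xs(3) by (simp add: adj_product_def)
    hence "\<pi> = adj_product (a # xs)" by (simp add: comp_assoc[symmetric])
    thus ?thesis using a xs by (intro exI[of _ "a # xs"]) auto
  qed
qed

lemma perm_length_eq_inversions:
  assumes "\<pi> \<in> Sym n"
  shows "perm_length n \<pi> = inversions n \<pi>"
  unfolding perm_length_def
  using reduced_word_exists[OF assms] adj_product_Sym_inversions
  by (intro Least_equality) auto

section \<open>Covers in the Bruhat order\<close>

lemma bruhat_step_iff:
  "(\<sigma>, \<tau>) \<in> bruhat_step n \<longleftrightarrow>
    \<sigma> \<in> Sym n \<and> (\<exists>i j. 1 \<le> i \<and> i < j \<and> j \<le> n \<and> \<sigma> i < \<sigma> j \<and> \<tau> = \<sigma> \<circ> transp i j)"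
proof
  assume "(\<sigma>, \<tau>) \<in> bruhat_step n"
  then obtain a b where \<sigma>: "\<sigma> \<in> Sym n" and ab: "1 \<le> a" "a < b" "b \<le> n"
    and \<tau>: "\<tau> = transp a b \<circ> \<sigma>" and len: "perm_length n \<sigma> < perm_length n \<tau>"
    by (auto simp: bruhat_step_def)
  have mem: "a \<in> {1..n}" "b \<in> {1..n}" using ab by auto
  obtain i j where ij: "1 \<le> i" "i < j" "j \<le> n" "transp a b \<circ> \<sigma> = \<sigma> \<circ> transp i j"
    "{\<sigma> i, \<sigma> j} = {a, b}"
    using value_swap_as_position_swap[OF \<sigma> mem] ab by auto
  have \<tau>S: "\<tau> \<in> Sym n" using Sym_compose_transp(1)[OF \<sigma> mem] \<tau> by simp
  have "\<sigma> i < \<sigma> j"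
  proof (rule ccontr)
    assume "\<not> \<sigma> i < \<sigma> j"
    hence "\<sigma> j < \<sigma> i" using ij(5) ab by (auto simp: doubleton_eq_iff)
    hence "inversions n (\<tau> \<circ> transp i j) = inversions n \<tau> + 1 + 2 * card (between_positions \<tau> i j)"
      using ij \<tau> by (intro inversions_swap Sym_inj_on[OF \<tau>S]) auto
    moreover have "\<tau> \<circ> transp i j = \<sigma>" using \<tau> ij(4) by (simp add: comp_assoc)
    ultimately show False
      using len perm_length_eq_inversions[OF \<sigma>] perm_length_eq_inversions[OF \<tau>S] by simp
  qed
  thus "\<sigma> \<in> Sym n \<and> (\<exists>i j. 1 \<le> i \<and> i < j \<and> j \<le> n \<and> \<sigma> i < \<sigma> j \<and> \<tau> = \<sigma> \<circ> transp i j)"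
    using \<sigma> ij \<tau> by blast
next
  assume "\<sigma> \<in> Sym n \<and> (\<exists>i j. 1 \<le> i \<and> i < j \<and> j \<le> n \<and> \<sigma> i < \<sigma> j \<and> \<tau> = \<sigma> \<circ> transp i j)"
  then obtain i j where \<sigma>: "\<sigma> \<in> Sym n" and ij: "1 \<le> i" "i < j" "j \<le> n" "\<sigma> i < \<sigma> j"
    and \<tau>: "\<tau> = \<sigma> \<circ> transp i j" by blast
  have perm: "\<sigma> permutes {1..n}" using \<sigma> by (simp add: Sym_def)
  have rng: "\<sigma> i \<in> {1..n}" "\<sigma> j \<in> {1..n}" unfolding permutes_in_image[OF perm] using ij by auto
  have value_swap: "transp (\<sigma> i) (\<sigma> j) \<circ> \<sigma> = \<sigma> \<circ> transp i j"
    by (rule transp_compose_inj[OF Sym_inj[OF \<sigma>]])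
  have \<tau>S: "\<tau> \<in> Sym n" using Sym_compose_transp(2)[OF \<sigma>] ij \<tau> by simp
  have "inversions n \<sigma> < inversions n \<tau>"
    using inversions_swap[OF Sym_inj_on[OF \<sigma>] ij] \<tau> by simp
  hence len: "perm_length n \<sigma> < perm_length n \<tau>"
    by (simp add: perm_length_eq_inversions \<sigma> \<tau>S)
  have "\<exists>a b. 1 \<le> a \<and> a < b \<and> b \<le> n \<and> \<tau> = transp a b \<circ> \<sigma>"
    unfolding \<tau> value_swap[symmetric] using rng ij(4)
    by (intro exI[of _ "\<sigma> i"] exI[of _ "\<sigma> j"]) auto
  thus "(\<sigma>, \<tau>) \<in> bruhat_step n"
    unfolding bruhat_step_def using \<sigma> len by blast
qed

lemma bruhat_step_Sym:
  assumes "(\<sigma>, \<tau>) \<in> bruhat_step n"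
  shows "\<sigma> \<in> Sym n" "\<tau> \<in> Sym n" "inversions n \<sigma> < inversions n \<tau>"
proof -
  show \<sigma>: "\<sigma> \<in> Sym n" using assms by (simp add: bruhat_step_iff)
  show \<tau>: "\<tau> \<in> Sym n"
    using assms Sym_compose_transp(2)[OF \<sigma>] by (auto simp: bruhat_step_iff)
  show "inversions n \<sigma> < inversions n \<tau>"
    using assms \<sigma> \<tau> by (simp add: bruhat_step_def perm_length_eq_inversions)
qed

text \<open>
  Inversions strictly increase along every step, so a nonempty chain of steps never returns to
  its starting point.
\<close>

lemma bruhat_less_iff_trancl: "bruhat_less n \<sigma> \<tau> \<longleftrightarrow> (\<sigma>, \<tau>) \<in> (bruhat_step n)\<^sup>+"
  and bruhat_less_inversions: "bruhat_less n \<sigma> \<tau> \<Longrightarrow> inversions n \<sigma> < inversions n \<tau>"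
proof -
  have *: "\<sigma> \<in> Sym n \<and> \<tau> \<in> Sym n \<and> inversions n \<sigma> < inversions n \<tau>"
    if "(\<sigma>, \<tau>) \<in> (bruhat_step n)\<^sup>+" for \<sigma> \<tau>
    using that
  proof (induction rule: trancl_induct)
    case (base \<tau>)
    show ?case using bruhat_step_Sym[OF base] by simp
  next
    case (step \<rho> \<tau>)
    show ?case using bruhat_step_Sym[OF step.hyps(2)] step.IH by simp
  qed
  show iff: "bruhat_less n \<sigma> \<tau> \<longleftrightarrow> (\<sigma>, \<tau>) \<in> (bruhat_step n)\<^sup>+"
    using *[of \<sigma> \<tau>] by (auto simp: bruhat_less_def bruhat_le_def rtrancl_eq_or_trancl)
  show "inversions n \<sigma> < inversions n \<tau>" if "bruhat_less n \<sigma> \<tau>" using that * iff by blast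
qed

text \<open>
  If some position \<open>k\<close> lies between \<open>i\<close> and \<open>j\<close> in position and in value, the exchange is
  refined by three upward steps. On the entries at \<open>i < k < j\<close>, with values \<open>x < y < z\<close>, these
  are \<open>x y z \<rightarrow> y x z \<rightarrow> y z x \<rightarrow> z y x\<close>. Conversely, without such a \<open>k\<close> the number of inversions
  grows by one, which leaves no room for an intermediate element.
\<close>

lemma bruhat_covers_iff:
  "bruhat_covers n \<tau> \<sigma> \<longleftrightarrow> \<sigma> \<in> Sym n \<and>
    (\<exists>i j. 1 \<le> i \<and> i < j \<and> j \<le> n \<and> \<sigma> i < \<sigma> j \<and> between_positions \<sigma> i j = {} \<and> \<tau> = \<sigma> \<circ> transp i j)"
    (is "_ \<longleftrightarrow> ?rhs")
proof
  assume cov: "bruhat_covers n \<tau> \<sigma>"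
  have nomid: "\<not> (bruhat_less n \<sigma> \<rho> \<and> bruhat_less n \<rho> \<tau>)" for \<rho>
    using cov unfolding bruhat_covers_def by blast
  have "(\<sigma>, \<tau>) \<in> (bruhat_step n)\<^sup>+"
    using cov unfolding bruhat_covers_def bruhat_less_iff_trancl by blast
  then obtain \<rho> where "(\<sigma>, \<rho>) \<in> bruhat_step n" "(\<rho>, \<tau>) \<in> (bruhat_step n)\<^sup>*"
    by (meson tranclD)
  hence step: "(\<sigma>, \<tau>) \<in> bruhat_step n"
    using nomid[of \<rho>] by (metis bruhat_less_iff_trancl r_into_trancl rtrancl_eq_or_trancl)
  then obtain i j where \<sigma>: "\<sigma> \<in> Sym n" and ij: "1 \<le> i" "i < j" "j \<le> n" "\<sigma> i < \<sigma> j"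
    and \<tau>: "\<tau> = \<sigma> \<circ> transp i j" by (auto simp: bruhat_step_iff)
  have "between_positions \<sigma> i j = {}"
  proof (rule ccontr)
    assume "between_positions \<sigma> i j \<noteq> {}"
    then obtain k where k: "i < k" "k < j" "\<sigma> i < \<sigma> k" "\<sigma> k < \<sigma> j" by (auto simp: between_positions_def)
    let ?\<rho>1 = "\<sigma> \<circ> transp i k"
    let ?\<rho>2 = "?\<rho>1 \<circ> transp k j"
    have S1: "?\<rho>1 \<in> Sym n" and S2: "?\<rho>2 \<in> Sym n"
      using \<sigma> ij k by (auto intro!: Sym_compose_transp(2))
    have 1: "(\<sigma>, ?\<rho>1) \<in> bruhat_step n"
      unfolding bruhat_step_iff using \<sigma> ij k by (intro conjI exI[of _ i] exI[of _ k]) auto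
    have 2: "(?\<rho>1, ?\<rho>2) \<in> bruhat_step n"
      unfolding bruhat_step_iff using S1 ij k
      by (intro conjI exI[of _ k] exI[of _ j]) (auto simp: Transposition.transpose_def)
    have eq: "\<tau> = ?\<rho>2 \<circ> transp i k"
      using transpose_comp_triple[of i j k] ij k by (simp add: \<tau> comp_assoc)
    have 3: "(?\<rho>2, \<tau>) \<in> bruhat_step n"
      unfolding bruhat_step_iff using S2 ij k eq
      by (intro conjI exI[of _ i] exI[of _ k]) (auto simp: Transposition.transpose_def)
    show False
      using nomid[of ?\<rho>1] 1 trancl_into_trancl[OF r_into_trancl[OF 2] 3]
      unfolding bruhat_less_iff_trancl by blast
  qed
  thus ?rhs using \<sigma> ij \<tau> by blast
next
  assume ?rhs
  then obtain i j where \<sigma>: "\<sigma> \<in> Sym n" and ij: "1 \<le> i" "i < j" "j \<le> n" "\<sigma> i < \<sigma> j"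
    and emp: "between_positions \<sigma> i j = {}" and \<tau>: "\<tau> = \<sigma> \<circ> transp i j" by blast
  have "(\<sigma>, \<tau>) \<in> bruhat_step n" using \<sigma> ij \<tau> by (auto simp: bruhat_step_iff)
  hence "bruhat_less n \<sigma> \<tau>" by (simp add: bruhat_less_iff_trancl r_into_trancl)
  moreover have "inversions n \<tau> = inversions n \<sigma> + 1"
    using inversions_swap[OF Sym_inj_on[OF \<sigma>] ij] emp \<tau> by simp
  ultimately show "bruhat_covers n \<tau> \<sigma>"
    unfolding bruhat_covers_def by (metis Suc_eq_plus1 bruhat_less_inversions less_antisym not_less_iff_gr_or_eq)
qed

text \<open>
  The values at \<open>q\<close> and \<open>p\<close> are neighbours, the one at \<open>q\<close> being the smaller, in the ordered
  list of the values on \<open>W\<close>. For the symmetry argument below \<open>W\<close> has to be a plain set, without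
  any relation between its order and the places of \<open>q\<close> and \<open>p\<close>.
\<close>

definition adjacent_in :: "'a set \<Rightarrow> ('a \<Rightarrow> 'b::linorder) \<Rightarrow> 'a \<Rightarrow> 'a \<Rightarrow> bool" where
  "adjacent_in W \<pi> q p \<longleftrightarrow> \<pi> q < \<pi> p \<and> (\<forall>r\<in>W. \<not> (\<pi> q < \<pi> r \<and> \<pi> r < \<pi> p))"

definition position_pairs :: "nat \<Rightarrow> (nat \<times> nat) set" where
  "position_pairs n = {(i, j). 1 \<le> i \<and> i < j \<and> j \<le> n}"

lemma finite_position_pairs: "finite (position_pairs n)"
  by (rule finite_subset[of _ "{1..n} \<times> {1..n}"]) (auto simp: position_pairs_def)

lemma adjacent_in_window_iff:
  assumes "i < j"
  shows "adjacent_in {i..j} \<pi> i j \<longleftrightarrow> \<pi> i < \<pi> j \<and> between_positions \<pi> i j = {}"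
    and "adjacent_in {i..j} \<pi> j i \<longleftrightarrow> \<pi> j < \<pi> i \<and> between_positions (\<pi> \<circ> transp i j) i j = {}"
proof -
  have inner: "r \<in> {i..j} \<longleftrightarrow> r = i \<or> r = j \<or> i < r \<and> r < j" for r using assms by auto
  show "adjacent_in {i..j} \<pi> i j \<longleftrightarrow> \<pi> i < \<pi> j \<and> between_positions \<pi> i j = {}"
    unfolding adjacent_in_def between_positions_def Ball_def inner by auto
  have "between_positions (\<pi> \<circ> transp i j) i j = {k. i < k \<and> k < j \<and> \<pi> j < \<pi> k \<and> \<pi> k < \<pi> i}"
    by (auto simp: between_positions_def Transposition.transpose_def split: if_splits)
  thus "adjacent_in {i..j} \<pi> j i \<longleftrightarrow> \<pi> j < \<pi> i \<and> between_positions (\<pi> \<circ> transp i j) i j = {}"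
    unfolding adjacent_in_def Ball_def inner by auto
qed

text \<open>
  Distinct pairs of positions give distinct elements below or above \<open>\<pi>\<close>, so degrees can be
  computed by counting pairs.
\<close>

lemma inj_on_compose_transp:
  assumes "inj \<pi>"
  shows "inj_on (\<lambda>(i, j). \<pi> \<circ> transp i j) (position_pairs n)"
proof (rule inj_onI, clarify)
  fix i j k l
  assume ij: "(i, j) \<in> position_pairs n" and kl: "(k, l) \<in> position_pairs n"
    and eq: "\<pi> \<circ> transp i j = \<pi> \<circ> transp k l"
  have t: "transp i j x = transp k l x" for x
    using fun_cong[OF eq, of x] assms by (simp add: inj_eq)
  show "i = k \<and> j = l"
    using t[of i] t[of j] ij kl
    by (auto simp: position_pairs_def Transposition.transpose_def split: if_splits)
qed

lemma card_covered:
  assumes \<pi>: "\<pi> \<in> Sym n"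
  shows "card {\<sigma>. bruhat_covers n \<pi> \<sigma>}
    = card {(i, j) \<in> position_pairs n. adjacent_in {i..j} \<pi> j i}" (is "_ = card ?D")
proof -
  have "{\<sigma>. bruhat_covers n \<pi> \<sigma>} = (\<lambda>(i, j). \<pi> \<circ> transp i j) ` ?D"
  proof (intro equalityI subsetI)
    fix \<sigma> assume "\<sigma> \<in> {\<sigma>. bruhat_covers n \<pi> \<sigma>}"
    then obtain i j where ij: "1 \<le> i" "i < j" "j \<le> n" "\<sigma> i < \<sigma> j" "between_positions \<sigma> i j = {}"
      and \<pi>\<sigma>: "\<pi> = \<sigma> \<circ> transp i j" unfolding mem_Collect_eq bruhat_covers_iff by blast
    have swap_back: "\<sigma> = \<pi> \<circ> transp i j" by (simp add: \<pi>\<sigma> comp_assoc)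
    have "(i, j) \<in> ?D"
      using ij by (simp add: position_pairs_def adjacent_in_window_iff \<pi>\<sigma> comp_assoc)
    thus "\<sigma> \<in> (\<lambda>(i, j). \<pi> \<circ> transp i j) ` ?D" by (rule rev_image_eqI) (simp add: swap_back[symmetric])
  next
    fix \<sigma> assume "\<sigma> \<in> (\<lambda>(i, j). \<pi> \<circ> transp i j) ` ?D"
    then obtain i j where ij: "1 \<le> i" "i < j" "j \<le> n" and adj: "adjacent_in {i..j} \<pi> j i"
      and \<sigma>: "\<sigma> = \<pi> \<circ> transp i j" by (auto simp: position_pairs_def)
    have "\<sigma> \<in> Sym n" unfolding \<sigma> using Sym_compose_transp(2)[OF \<pi>] ij by simp
    moreover have "\<sigma> i < \<sigma> j" "between_positions \<sigma> i j = {}" "\<pi> = \<sigma> \<circ> transp i j"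
      using adj ij by (simp_all add: \<sigma> adjacent_in_window_iff comp_assoc)
    ultimately show "\<sigma> \<in> {\<sigma>. bruhat_covers n \<pi> \<sigma>}"
      using ij unfolding mem_Collect_eq bruhat_covers_iff by blast
  qed
  moreover have "inj_on (\<lambda>(i, j). \<pi> \<circ> transp i j) ?D"
    by (rule inj_on_subset[OF inj_on_compose_transp[OF Sym_inj[OF \<pi>]]]) auto
  ultimately show ?thesis by (simp add: card_image)
qed

lemma card_covering:
  assumes \<pi>: "\<pi> \<in> Sym n"
  shows "card {\<sigma>. bruhat_covers n \<sigma> \<pi>}
    = card {(i, j) \<in> position_pairs n. adjacent_in {i..j} \<pi> i j}" (is "_ = card ?U")
proof -
  have "{\<sigma>. bruhat_covers n \<sigma> \<pi>} = (\<lambda>(i, j). \<pi> \<circ> transp i j) ` ?U"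
  proof (intro equalityI subsetI)
    fix \<sigma> assume "\<sigma> \<in> {\<sigma>. bruhat_covers n \<sigma> \<pi>}"
    then obtain i j where ij: "1 \<le> i" "i < j" "j \<le> n" "\<pi> i < \<pi> j" "between_positions \<pi> i j = {}"
      and \<sigma>: "\<sigma> = \<pi> \<circ> transp i j" unfolding mem_Collect_eq bruhat_covers_iff by blast
    have "(i, j) \<in> ?U" using ij by (simp add: position_pairs_def adjacent_in_window_iff)
    thus "\<sigma> \<in> (\<lambda>(i, j). \<pi> \<circ> transp i j) ` ?U" unfolding \<sigma> by (rule rev_image_eqI) simp
  next
    fix \<sigma> assume "\<sigma> \<in> (\<lambda>(i, j). \<pi> \<circ> transp i j) ` ?U"
    then obtain i j where ij: "1 \<le> i" "i < j" "j \<le> n" and adj: "adjacent_in {i..j} \<pi> i j"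
      and \<sigma>: "\<sigma> = \<pi> \<circ> transp i j" by (auto simp: position_pairs_def)
    show "\<sigma> \<in> {\<sigma>. bruhat_covers n \<sigma> \<pi>}"
      using ij adj \<pi> \<sigma> unfolding adjacent_in_window_iff(1)[OF ij(2)] mem_Collect_eq bruhat_covers_iff
      by blast
  qed
  moreover have "inj_on (\<lambda>(i, j). \<pi> \<circ> transp i j) ?U"
    by (rule inj_on_subset[OF inj_on_compose_transp[OF Sym_inj[OF \<pi>]]]) auto
  ultimately show ?thesis by (simp add: card_image)
qed

section \<open>Adjacent values in a window of a random permutation\<close>

text \<open>
  Every element of \<open>W\<close> except the one with the least value has exactly one predecessor.
\<close>

lemma card_adjacent_pairs:
  fixes \<pi> :: "'a \<Rightarrow> 'b::linorder"
  assumes W: "finite W" "W \<noteq> {}" and inj: "inj_on \<pi> W"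
  shows "card {(p, q) \<in> W \<times> W. adjacent_in W \<pi> q p} = card W - 1"
proof -
  let ?A = "{(p, q) \<in> W \<times> W. adjacent_in W \<pi> q p}"
  define m where "m = arg_min_on \<pi> W"
  have m: "m \<in> W" "\<And>x. x \<in> W \<Longrightarrow> \<pi> m \<le> \<pi> x"
    using arg_min_if_finite(1)[OF W, of \<pi>] arg_min_least[OF W, of _ \<pi>] by (auto simp: m_def)
  have uniq: "q = q'" if "adjacent_in W \<pi> q p" "adjacent_in W \<pi> q' p" "q \<in> W" "q' \<in> W" for p q q'
    using that inj by (metis adjacent_in_def inj_onD linorder_neqE)
  have fst_inj: "inj_on fst ?A" using uniq by (auto simp: inj_on_def)
  have fst_image: "fst ` ?A = W - {m}"
  proof (intro equalityI subsetI)
    fix p assume "p \<in> fst ` ?A"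
    thus "p \<in> W - {m}" using m by (force simp: adjacent_in_def)
  next
    fix p assume p: "p \<in> W - {m}"
    let ?B = "{q \<in> W. \<pi> q < \<pi> p}"
    have "\<pi> m \<noteq> \<pi> p" using p m(1) inj by (metis DiffE inj_onD insertI1)
    hence "m \<in> ?B" using m p by (simp add: order.not_eq_order_implies_strict)
    hence B: "finite ?B" "?B \<noteq> {}" using W by auto
    have "Max (\<pi> ` ?B) \<in> \<pi> ` ?B" using B by (intro Max_in) simp_all
    then obtain q where q: "q \<in> ?B" "Max (\<pi> ` ?B) = \<pi> q" by (rule imageE)
    have "\<not> (\<pi> q < \<pi> r \<and> \<pi> r < \<pi> p)" if r: "r \<in> W" for r
    proof
      assume less: "\<pi> q < \<pi> r \<and> \<pi> r < \<pi> p"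
      have "\<pi> r \<le> Max (\<pi> ` ?B)" using B r less by (intro Max_ge) auto
      thus False using less unfolding q(2) by (blast dest: leD)
    qed
    hence "(p, q) \<in> ?A" using p q(1) by (simp add: adjacent_in_def)
    thus "p \<in> fst ` ?A" by (rule rev_image_eqI) simp
  qed
  have "card ?A = card (W - {m})" using card_image[OF fst_inj] unfolding fst_image by (rule sym)
  also have "\<dots> = card W - 1" by (rule card_Diff_singleton[OF m(1)])
  finally show ?thesis .
qed

lemma permutation_moving_pair:
  assumes "p \<in> W" "q \<in> W" "p' \<in> W" "q' \<in> W" "p \<noteq> q" "p' \<noteq> q'"
  obtains \<theta> where "\<theta> permutes W" "\<theta> p' = p" "\<theta> q' = q"
proof
  \<comment> \<open>The first transposition takes \<open>p'\<close> to \<open>p\<close> and \<open>q'\<close> to some \<open>r \<noteq> p\<close>; the second corrects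
    \<open>r\<close> to \<open>q\<close> and leaves \<open>p\<close> alone.\<close>
  let ?r = "Transposition.transpose p' p q'"
  let ?\<theta> = "Transposition.transpose ?r q \<circ> Transposition.transpose p' p"
  show "?\<theta> permutes W"
    using assms by (intro permutes_compose permutes_swap_id) (auto simp: Transposition.transpose_def)
  show "?\<theta> p' = p" "?\<theta> q' = q" using assms by (auto simp: Transposition.transpose_def)
qed

text \<open>
  Composing with a permutation of \<open>W\<close> that moves one pair of distinct positions to another shows
  that the number of permutations with \<open>q\<close> directly below \<open>p\<close> is the same for all
  \<open>card W * (card W - 1)\<close> ordered pairs. By double counting with \<open>card_adjacent_pairs\<close> these
  numbers add up to \<open>card W - 1\<close> times the number of permutations.
\<close>

lemma card_permutations_adjacent:
  fixes A :: "'a::linorder set"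
  assumes A: "finite A" and W: "W \<subseteq> A" and p: "p \<in> W" and q: "q \<in> W" and pq: "p \<noteq> q"
  shows "card W * card {\<pi>. \<pi> permutes A \<and> adjacent_in W \<pi> q p} = fact (card A)"
proof -
  let ?S = "{\<pi>. \<pi> permutes A}"
  define E where "E p q = {\<pi> \<in> ?S. adjacent_in W \<pi> q p}" for p q
  define P where "P = {(p, q). p \<in> W \<and> q \<in> W \<and> p \<noteq> q}"
  have finW: "finite W" and finS: "finite ?S"
    using A W by (auto intro: finite_subset finite_permutations)
  have le: "card (E p q) \<le> card (E p' q')"
    if pq: "p \<in> W" "q \<in> W" "p \<noteq> q" and pq': "p' \<in> W" "q' \<in> W" "p' \<noteq> q'" for p q p' q'
  proof -
    obtain \<theta> where \<theta>: "\<theta> permutes W" "\<theta> p' = p" "\<theta> q' = q"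
      using permutation_moving_pair pq pq' by metis
    have surj: "surj \<theta>" using \<theta>(1) permutes_surj by blast
    have stable: "\<theta> r \<in> W" if "r \<in> W" for r
      unfolding permutes_in_image[OF \<theta>(1)] using that .
    have "\<pi> \<circ> \<theta> \<in> E p' q'" if \<pi>: "\<pi> \<in> E p q" for \<pi>
    proof -
      have "\<pi> \<circ> \<theta> permutes A"
        using \<pi> permutes_compose[OF permutes_subset[OF \<theta>(1) W]] unfolding E_def by blast
      moreover have "adjacent_in W (\<pi> \<circ> \<theta>) q' p'"
        using \<pi> \<theta>(2,3) stable by (simp add: E_def adjacent_in_def)
      ultimately show ?thesis by (simp add: E_def)
    qed
    moreover have "inj_on (\<lambda>\<pi>. \<pi> \<circ> \<theta>) (E p q)"
    proof (rule inj_onI)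
      fix \<pi> \<rho> assume "\<pi> \<circ> \<theta> = \<rho> \<circ> \<theta>"
      thus "\<pi> = \<rho>" using surj by (metis comp_assoc comp_id surj_iff)
    qed
    moreover have "finite (E p' q')" using finS by (simp add: E_def)
    ultimately show ?thesis by (intro card_inj_on_le[of "\<lambda>\<pi>. \<pi> \<circ> \<theta>"]) auto
  qed
  have const: "card (E (fst z) (snd z)) = card (E p q)" if "z \<in> P" for z
    using that p q pq by (intro antisym le) (auto simp: P_def)
  have finP: "finite P" by (rule finite_subset[of _ "W \<times> W"]) (auto simp: P_def finW)
  have P_eq: "P = W \<times> W - (\<lambda>w. (w, w)) ` W" by (auto simp: P_def)
  have diag: "card ((\<lambda>w. (w, w)) ` W) = card W" by (intro card_image) (auto simp: inj_on_def)
  have "card P = card (W \<times> W) - card ((\<lambda>w. (w, w)) ` W)"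
    unfolding P_eq by (rule card_Diff_subset) (auto simp: finW)
  hence cardP: "card P = card W * (card W - 1)"
    by (simp add: diag card_cartesian_product diff_mult_distrib2)
  have "card P * card (E p q) = (\<Sum>z\<in>P. card (E (fst z) (snd z)))" using const by simp
  also have "\<dots> = (\<Sum>z\<in>P. \<Sum>\<pi>\<in>?S. of_bool (adjacent_in W \<pi> (snd z) (fst z)))"
    using finS by (simp add: E_def Int_def)
  also have "\<dots> = (\<Sum>\<pi>\<in>?S. \<Sum>z\<in>P. of_bool (adjacent_in W \<pi> (snd z) (fst z)))"
    by (rule sum.swap)
  also have "\<dots> = (\<Sum>\<pi>\<in>?S. card W - 1)"
  proof (intro sum.cong refl)
    fix \<pi> assume "\<pi> \<in> ?S"
    hence "inj_on \<pi> W" using permutes_inj_on by blast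
    hence "card {(p, q) \<in> W \<times> W. adjacent_in W \<pi> q p} = card W - 1"
      using finW p by (intro card_adjacent_pairs) auto
    moreover have "{(p, q) \<in> W \<times> W. adjacent_in W \<pi> q p} = {z \<in> P. adjacent_in W \<pi> (snd z) (fst z)}"
      by (auto simp: P_def adjacent_in_def)
    ultimately show "(\<Sum>z\<in>P. of_bool (adjacent_in W \<pi> (snd z) (fst z))) = card W - 1"
      using finP by (simp add: of_bool_def sum.If_cases Int_def)
  qed
  also have "\<dots> = fact (card A) * (card W - 1)" using A by (simp add: card_permutations)
  finally have "(card W - 1) * (card W * card (E p q)) = (card W - 1) * fact (card A)"
    unfolding cardP by (simp add: ac_simps)
  moreover have "card W \<noteq> 1" using p q pq finW by (metis card_1_singletonE singletonD)
  moreover have "card W \<noteq> 0" using p finW by auto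
  ultimately show ?thesis by (simp add: E_def)
qed

section \<open>The expected degrees\<close>

lemma sum_card_pairs:
  assumes pair: "\<And>i j. 1 \<le> i \<Longrightarrow> i < j \<Longrightarrow> j \<le> n \<Longrightarrow>
      card {\<pi> \<in> Sym n. Q \<pi> i j} * card {i..j} = fact n"
  shows "(\<Sum>\<pi>\<in>Sym n. real (card {(i, j) \<in> position_pairs n. Q \<pi> i j}))
    = fact n * (\<Sum>(i, j)\<in>position_pairs n. 1 / real (Suc j - i))"
proof -
  have as_sum: "real (card {(i, j) \<in> position_pairs n. Q \<pi> i j})
      = (\<Sum>z\<in>position_pairs n. of_bool (Q \<pi> (fst z) (snd z)))" for \<pi>
  proof -
    have "{(i, j) \<in> position_pairs n. Q \<pi> i j}
        = {z \<in> position_pairs n. Q \<pi> (fst z) (snd z)}" by auto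
    thus ?thesis by (simp only: of_nat_card_filter[OF finite_position_pairs])
  qed
  have "(\<Sum>\<pi>\<in>Sym n. real (card {(i, j) \<in> position_pairs n. Q \<pi> i j}))
      = (\<Sum>\<pi>\<in>Sym n. \<Sum>z\<in>position_pairs n. of_bool (Q \<pi> (fst z) (snd z)))"
    by (simp only: as_sum)
  also have "\<dots> = (\<Sum>z\<in>position_pairs n. \<Sum>\<pi>\<in>Sym n. of_bool (Q \<pi> (fst z) (snd z)))"
    by (rule sum.swap)
  also have "\<dots> = (\<Sum>z\<in>position_pairs n. fact n * (1 / real (Suc (snd z) - fst z)))"
  proof (intro sum.cong refl)
    fix z assume "z \<in> position_pairs n"
    then obtain i j where z: "z = (i, j)" and ij: "1 \<le> i" "i < j" "j \<le> n"
      by (auto simp: position_pairs_def)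
    have "real (card {\<pi> \<in> Sym n. Q \<pi> i j}) * real (Suc j - i) = fact n"
      using arg_cong[OF pair[OF ij], of real] by (simp only: of_nat_mult of_nat_fact card_atLeastAtMost)
    hence "real (card {\<pi> \<in> Sym n. Q \<pi> i j}) = fact n * (1 / real (Suc j - i))"
      using ij by (simp add: field_simps)
    thus "(\<Sum>\<pi>\<in>Sym n. of_bool (Q \<pi> (fst z) (snd z))) = fact n * (1 / real (Suc (snd z) - fst z))"
      by (simp only: z fst_conv snd_conv of_nat_card_filter[OF finite_Sym])
  qed
  finally show ?thesis by (simp only: sum_distrib_left case_prod_unfold)
qed

text \<open>
  Raising \<open>n\<close> by one adds the windows that end in \<open>n + 1\<close>. Their sizes are \<open>2, \<dots>, n + 1\<close>, so they
  contribute the next harmonic number minus one.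
\<close>

lemma sum_inverse_window_sizes:
  "(\<Sum>(i, j)\<in>position_pairs n. 1 / real (Suc j - i)) = real (n + 1) * harm n - 2 * real n"
proof (induction n)
  case 0
  have "position_pairs 0 = {}" by (auto simp: position_pairs_def)
  thus ?case by (simp add: harm_def)
next
  case (Suc n)
  have split: "position_pairs (Suc n) = position_pairs n \<union> (\<lambda>i. (i, Suc n)) ` {1..n}"
    by (auto simp: position_pairs_def)
  have disj: "position_pairs n \<inter> (\<lambda>i. (i, Suc n)) ` {1..n} = {}"
    by (auto simp: position_pairs_def)
  have "(\<Sum>(i, j)\<in>(\<lambda>i. (i, Suc n)) ` {1..n}. 1 / real (Suc j - i))
      = (\<Sum>i\<in>{1..n}. 1 / real (Suc (Suc n) - i))"
    by (subst sum.reindex) (auto simp: inj_on_def)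
  also have "\<dots> = (\<Sum>k\<in>{2..Suc n}. inverse (real k))"
    by (rule sum.reindex_bij_witness[of _ "\<lambda>k. Suc (Suc n) - k" "\<lambda>i. Suc (Suc n) - i"])
       (auto simp: divide_inverse)
  also have "\<dots> = harm (Suc n) - 1"
    unfolding harm_def by (subst (2) sum.atLeast_Suc_atMost) (auto simp: numeral_2_eq_2)
  finally show ?case
    unfolding split
    by (subst sum.union_disjoint[OF finite_position_pairs _ disj])
       (auto simp: Suc.IH harm_Suc field_simps)
qed

lemma expected_degrees:
  shows expect_down_degree:
    "expect_Sym n (\<lambda>\<pi>. real (down_degree n \<pi>)) = real (n + 1) * harm n - 2 * real n"
    and expect_total_degree:
    "expect_Sym n (\<lambda>\<pi>. real (total_degree n \<pi>)) = 2 * (real (n + 1) * harm n - 2 * real n)"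
proof -
  have ne: "Sym n \<noteq> {}" using card_Sym[of n] by (metis card.empty fact_nonzero)
  have E: "expect_Sym n f = (\<Sum>\<pi>\<in>Sym n. f \<pi>) / fact n" for f
    unfolding expect_Sym_def using integral_pmf_of_set[OF ne finite_Sym] card_Sym by simp
  have adj: "card {\<pi> \<in> Sym n. adjacent_in {i..j} \<pi> q p} * card {i..j} = fact n"
    if "1 \<le> i" "j \<le> n" "p \<in> {i..j}" "q \<in> {i..j}" "p \<noteq> q" for i j p q
    using card_permutations_adjacent[of "{1..n}" "{i..j}" p q] that
    by (simp add: Sym_def ac_simps)
  have down: "(\<Sum>\<pi>\<in>Sym n. real (card {\<sigma>. bruhat_covers n \<pi> \<sigma>}))
      = fact n * (real (n + 1) * harm n - 2 * real n)"
    using sum_card_pairs[of n "\<lambda>\<pi> i j. adjacent_in {i..j} \<pi> j i"] adj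
    by (simp add: card_covered sum_inverse_window_sizes)
  have up: "(\<Sum>\<pi>\<in>Sym n. real (card {\<sigma>. bruhat_covers n \<sigma> \<pi>}))
      = fact n * (real (n + 1) * harm n - 2 * real n)"
    using sum_card_pairs[of n "\<lambda>\<pi> i j. adjacent_in {i..j} \<pi> i j"] adj
    by (simp add: card_covering sum_inverse_window_sizes)
  show "expect_Sym n (\<lambda>\<pi>. real (down_degree n \<pi>)) = real (n + 1) * harm n - 2 * real n"
    using down by (simp add: E down_degree_def)
  show "expect_Sym n (\<lambda>\<pi>. real (total_degree n \<pi>)) = 2 * (real (n + 1) * harm n - 2 * real n)"
    using down up by (simp add: E total_degree_def sum.distrib)
qed

lemma harm_asymptotics:
  "(\<lambda>n. real (n + 1) * harm n - 2 * real n - real n * ln (real n)) \<in> O(\<lambda>n. real n)"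
proof (rule bigoI[of _ 4], rule eventually_sequentiallyI[of 1])
  fix n :: nat assume n: "1 \<le> n"
  have lower: "ln (real n) \<le> harm n"
    using euler_mascheroni_sequence_nonneg[of n] n by simp
  have upper: "harm n \<le> ln (real n) + (1::real)"
    using euler_mascheroni_sequence_decreasing[of 1 n] n by (simp add: harm_expand)
  have log: "ln (real n) \<le> real n - 1" "0 \<le> ln (real n)"
    using n by (simp_all add: ln_le_minus_one)
  have main: "0 \<le> real n * (harm n - ln (real n))" "real n * (harm n - ln (real n)) \<le> real n"
    using lower upper by (auto intro: mult_left_le)
  have "real (n + 1) * harm n - 2 * real n - real n * ln (real n)
      = real n * (harm n - ln (real n)) + harm n - 2 * real n"
    by (simp add: algebra_simps)
  \<comment> \<open>The three summands have absolute value at most \<open>n\<close>, \<open>n\<close> and \<open>2 n\<close>.\<close>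
  moreover have "\<bar>real n * (harm n - ln (real n)) + harm n - 2 * real n\<bar> \<le> 4 * \<bar>real n\<bar>"
    using lower upper log main by linarith
  ultimately show "norm (real (n + 1) * harm n - 2 * real n - real n * ln (real n))
      \<le> 4 * norm (real n)"
    by (simp only: real_norm_def)
qed

theorem corollary4p2:
  "(\<lambda>n::nat. expect_Sym n (\<lambda>\<pi>. real (down_degree n \<pi>)) - real n * ln (real n))
     \<in> O(\<lambda>n. real n)
   \<and> (\<lambda>n::nat. expect_Sym n (\<lambda>\<pi>. real (total_degree n \<pi>)) - 2 * real n * ln (real n))
     \<in> O(\<lambda>n. real n)"
proof
  show "(\<lambda>n::nat. expect_Sym n (\<lambda>\<pi>. real (down_degree n \<pi>)) - real n * ln (real n))
      \<in> O(\<lambda>n. real n)"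
    using harm_asymptotics by (simp add: expect_down_degree)
  have "(\<lambda>n. 2 * (real (n + 1) * harm n - 2 * real n - real n * ln (real n))) \<in> O(\<lambda>n. real n)"
    by (subst landau_o.big.cmult_in_iff) (simp, rule harm_asymptotics)
  moreover have "(\<lambda>n::nat. expect_Sym n (\<lambda>\<pi>. real (total_degree n \<pi>)) - 2 * real n * ln (real n))
      = (\<lambda>n. 2 * (real (n + 1) * harm n - 2 * real n - real n * ln (real n)))"
    by (rule ext) (simp add: expect_total_degree algebra_simps)
  ultimately show "(\<lambda>n::nat. expect_Sym n (\<lambda>\<pi>. real (total_degree n \<pi>)) - 2 * real n * ln (real n))
      \<in> O(\<lambda>n. real n)"
    by (simp only:)
qed

end
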